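(* Put $a_0=\frac{800001}{1000000}$ and $p_0=1100000$. For every real $p\ge p_0$, let $\alpha_p=a_0p-2$. Then $(p,\alpha_p)$ is admissible, i.e. $-1<\alpha_p<p-2$, and \[ \|\mathcal H\|_{A^p_{\alpha_p}\to A^p_{\alpha_p}}>\mathrm B(a_0,1-a_0). \] In particular, the identity \[ \|\mathcal H\|_{A^p_\alpha\to A^p_\alpha}=\mathrm B(a,1-a)=\frac{\pi}{\sin(\pi a)},\qquad a=\frac{\alpha+2}{p}, \] fails for every even exponent $p=2m$, with $m\ge 550000$ an integer, at the corresponding weight $\alpha=\alpha_{2m}=2a_0m-2$.
   Context: Let $\mathbb D$ be the open unit disk and $dA(z)=\pi^{-1}\,dx\,dy$ normalized area measure. For $\alpha>-1$ put $dA_\alpha(z)=(\alpha+1)(1-|z|^2)^\alpha\,dA(z)$. The weighted Bergman space $A^p_\alpha$ consists of analytic functions $f$ on $\mathbb D$ with $\|f\|_{A^p_\alpha}^p=\int_{\mathbb D}|f|^p\,dA_\alpha<\infty$. The Hilbert matrix operator is, for $f(z)=\sum_{k\ge0}a_kz^k$, \[ \mathcal Hf(z)=\sum_{n=0}^\infty\Big(\sum_{k=0}^\infty\frac{a_k}{n+k+1}\Big)z^n=\int_0^1\frac{f(t)}{1-tz}\,dt, \] (initially for polynomials). The natural boundedness range of $\mathcal H$ on $A^p_\alpha$ is $\alpha>-1$, $p>\alpha+2$ (admissible pairs $(p,\alpha)$), and $\|\mathcal H\|_{A^p_\alpha\to A^p_\alpha}$ denotes the operator norm. $\mathrm B(x,y)=\int_0^1t^{x-1}(1-t)^{y-1}\,dt$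 is the beta function. *)

theory Defs
  imports "HOL-Complex_Analysis.Complex_Analysis"
begin

definition disk_measure :: "real \<Rightarrow> complex measure" where
  "disk_measure \<alpha> = density (restrict_space lborel (ball 0 1))
     (\<lambda>z. ennreal ((\<alpha> + 1) * (1 - (norm z)\<^sup>2) powr \<alpha> / pi))"

text \<open>The norm is extended-valued, so that the image of a function under an operator that is not
  known to be bounded always has a meaningful norm.\<close>

definition bergman_norm :: "real \<Rightarrow> real \<Rightarrow> (complex \<Rightarrow> complex) \<Rightarrow> ennreal" where
  "bergman_norm p \<alpha> f =
     (let I = (\<integral>\<^sup>+ z. ennreal (norm (f z) powr p) \<partial>disk_measure \<alpha>)
      in if I = top then top else ennreal (enn2real I powr (1 / p)))"

definition bergman_space :: "real \<Rightarrow> real \<Rightarrow> (complex \<Rightarrow> complex) set" where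
  "bergman_space p \<alpha> = {f. f holomorphic_on ball 0 1 \<and> bergman_norm p \<alpha> f < top}"

text \<open>For \<open>-1 < \<alpha> < p - 2\<close> every \<open>f\<close> in the Bergman space satisfies
  \<open>\<bar>f t\<bar> \<le> C * (1 - t) powr (- (\<alpha> + 2) / p)\<close> with \<open>(\<alpha> + 2) / p < 1\<close>, so the integral converges
  absolutely on the whole space. On polynomials it is given by the Hilbert matrix
  (lemma \<open>hilbert_op_poly\<close>).\<close>

definition hilbert_op :: "(complex \<Rightarrow> complex) \<Rightarrow> complex \<Rightarrow> complex" where
  "hilbert_op f z = (LINT t:{0<..<1}|lborel. f (complex_of_real t) / (1 - complex_of_real t * z))"

definition hilbert_norm :: "real \<Rightarrow> real \<Rightarrow> ennreal" where
  "hilbert_norm p \<alpha> =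
     (SUP f \<in> {f \<in> bergman_space p \<alpha>. bergman_norm p \<alpha> f \<le> 1}. bergman_norm p \<alpha> (hilbert_op f))"

lemma hilbert_op_poly:
  fixes q :: "complex poly" and z :: complex
  assumes z: "norm z < 1"
  shows "(\<lambda>n. (\<Sum>k\<le>degree q. coeff q k / of_nat (n + k + 1)) * z ^ n) sums hilbert_op (poly q) z"
proof -
  define F where "F = (\<lambda>n (t::real). poly q (of_real t) * (of_real t * z) ^ n)"
  have contF: "continuous_on {0..1} (F n)" for n
    unfolding F_def by (intro continuous_intros)
  have moment: "((\<lambda>t. complex_of_real t ^ m) has_integral 1 / of_nat (m + 1)) {0..1}" for m
  proof -
    have eq: "(x ^ m + of_nat m * x ^ (m - Suc 0) * x) / of_nat (Suc m) = x ^ m" for x :: complex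
      by (cases m) (simp_all add: divide_simps algebra_simps del: of_nat_Suc, simp add: algebra_simps)
    have "((\<lambda>t. of_real t ^ m :: complex) has_integral
        (of_real 1 ^ Suc m / of_nat (Suc m) - of_real 0 ^ Suc m / of_nat (Suc m))) {0..1}"
      by (rule fundamental_theorem_of_calculus)
        (auto intro!: derivative_eq_intros has_vector_derivative_real_field
          simp: eq simp del: of_nat_Suc)
    then show ?thesis by simp
  qed
  have intF: "(F n has_integral (\<Sum>k\<le>degree q. coeff q k / of_nat (n + k + 1)) * z ^ n) {0..1}" for n
  proof -
    have "((\<lambda>t. \<Sum>k\<le>degree q. coeff q k * z ^ n * complex_of_real t ^ (n + k)) has_integral
       (\<Sum>k\<le>degree q. coeff q k * z ^ n * (1 / of_nat (n + k + 1)))) {0..1}"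
      by (intro has_integral_sum has_integral_mult_right moment) auto
    also have "(\<lambda>t. \<Sum>k\<le>degree q. coeff q k * z ^ n * complex_of_real t ^ (n + k)) = F n"
      by (rule ext, unfold F_def poly_altdef sum_distrib_right, rule sum.cong)
        (auto simp: power_mult_distrib power_add)
    finally show ?thesis
      by (simp add: sum_distrib_right)
  qed
  have bq: "bounded ((\<lambda>t. poly q (complex_of_real t)) ` {0..1})"
    by (intro compact_imp_bounded compact_continuous_image continuous_intros) auto
  then obtain B where B: "norm (poly q (complex_of_real t)) \<le> B" if "t \<in> {0..1}" for t
    unfolding bounded_iff by (metis imageI)
  have B0: "0 \<le> B" using order_trans[OF norm_ge_zero B[of 0]] by simp
  have bound: "norm (F n t) \<le> B * norm z ^ n" if "t \<in> {0..1}" for n t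
  proof -
    have "norm (complex_of_real t * z) ^ n \<le> norm z ^ n"
      using that by (intro power_mono) (auto simp: norm_mult intro: mult_left_le_one_le)
    then show ?thesis unfolding F_def norm_mult norm_power
      by (intro mult_mono B[OF that] B0) (auto simp: norm_mult)
  qed
  have unif: "uniform_limit {0..1} (\<lambda>N t. \<Sum>n<N. F n t) (\<lambda>t. \<Sum>n. F n t) sequentially"
    by (rule Weierstrass_m_test[where M = "\<lambda>n. B * norm z ^ n"])
      (use bound z in \<open>auto intro!: summable_mult summable_geometric\<close>)
  have sumF: "(\<Sum>n. F n t) = poly q (of_real t) / (1 - of_real t * z)" if "t \<in> {0..1}" for t
  proof -
    have "norm (complex_of_real t * z) \<le> norm z"
      using that by (auto simp: norm_mult intro: mult_left_le_one_le)
    then have "(\<lambda>n. (of_real t * z) ^ n) sums (1 / (1 - of_real t * z))"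
      using z by (intro geometric_sums) auto
    from sums_mult[OF this, of "poly q (of_real t)"] show ?thesis
      by (auto simp: F_def sums_iff)
  qed
  define G where "G = (\<lambda>t. poly q (complex_of_real t) / (1 - of_real t * z))"
  have unif': "uniform_limit {0..1} (\<lambda>N t. \<Sum>n<N. F n t) G sequentially"
    using unif by (rule uniform_limit_cong'[THEN iffD1, rotated 2]) (auto simp: sumF G_def)
  have contG: "continuous_on {0..1} G"
    by (rule uniform_limit_theorem[OF _ unif']) (auto intro!: always_eventually continuous_on_sum contF)
  have lim: "(\<lambda>N. integral {0..1} (\<lambda>t. \<Sum>n<N. F n t)) \<longlonglongrightarrow> integral {0..1} G"
  proof -
    obtain I J where "\<And>N. ((\<lambda>t. \<Sum>n<N. F n t) has_integral I N) {0..1}" "(G has_integral J) {0..1}"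
      "I \<longlonglongrightarrow> J"
      by (rule uniform_limit_integral[OF unif']) (auto intro!: continuous_on_sum contF)
    moreover from this have "I = (\<lambda>N. integral {0..1} (\<lambda>t. \<Sum>n<N. F n t))" "J = integral {0..1} G"
      by (blast intro: ext integral_unique[symmetric])+
    ultimately show ?thesis by simp
  qed
  have "integral {0..1} (\<lambda>t. \<Sum>n<N. F n t) =
      (\<Sum>n<N. (\<Sum>k\<le>degree q. coeff q k / of_nat (n + k + 1)) * z ^ n)" for N
    by (intro integral_unique has_integral_sum intF) auto
  with lim have sums: "(\<lambda>n. (\<Sum>k\<le>degree q. coeff q k / of_nat (n + k + 1)) * z ^ n) sums integral {0..1} G"
    by (simp add: sums_def)
  have "set_integrable lborel {0..1} G"
    by (rule borel_integrable_atLeastAtMost') (rule contG)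
  then have si: "set_integrable lborel {0<..<1} G"
    by (rule set_integrable_subset) auto
  have "hilbert_op (poly q) z = integral {0<..<1} G"
    unfolding hilbert_op_def using set_borel_integral_eq_integral(2)[OF si] by (simp add: G_def)
  also have "\<dots> = integral {0..1} G"
    using integral_open_interval[of 0 1 G] by (simp add: box_real)
  finally show ?thesis using sums by simp
qed

end

theory Submission
  imports Defs
begin

text \<open>For \<open>p \<rightarrow> \<infinity>\<close> and \<open>\<alpha> = a p - 2\<close> the Bergman norm becomes the growth norm
  \<open>sup \<bar>f z\<bar> (1 - \<bar>z\<bar>\<^sup>2)\<^sup>a\<close>, for which \<open>(1 - z\<^sup>2)\<^sup>-\<^sup>a\<close> is extremal. On the radius,
  \<open>(1 - r\<^sup>2)\<^sup>a \<integral> (1 - t\<^sup>2)\<^sup>-\<^sup>a / (1 - r t) dt\<close> tends to \<open>B(a, 1 - a)\<close> as \<open>r \<rightarrow> 1\<close>, but for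
  \<open>a\<close> near \<open>4/5\<close> it exceeds this limit by a factor of about \<open>1 + 10\<^sup>-\<^sup>4\<close> at \<open>r = 1024/1025\<close>.
  Replacing the exponent \<open>a\<close> by \<open>4/5\<close> costs little and puts the function \<open>(1 - z\<^sup>2)\<^sup>-\<^sup>4\<^sup>/\<^sup>5\<close> into the
  space, since \<open>p (a - 4/5) \<ge> 1.1 > 1\<close>. Raised to the power \<open>p\<close>, the surplus factor
  outweighs the area lost by integrating its image over a tiny disc around \<open>r\<close> only.\<close>

section \<open>The extremal integral on the radius\<close>

text \<open>The cubic is the Taylor polynomial at 0 of the right-hand side. After multiplication by
  \<open>(1 - x/2) powr (4/5)\<close> the derivative loses all terms below order 3 and is
  nonpositive, so the product never rises above its value 1 at 0.\<close>

lemma cubic_le_powr_four_fifths: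
  fixes x :: real
  assumes "0 \<le> x" "x \<le> 1"
  shows "1 + 2/5 * x + 9/50 * x^2 + 21/250 * x^3 \<le> (1 - x/2) powr (-4/5)"
proof -
  define g where "g = (\<lambda>x::real. (1 + 2/5 * x + 9/50 * x^2 + 21/250 * x^3) * (1 - x/2) powr (4/5))"
  have "g x \<le> g 0"
  proof (rule DERIV_nonpos_imp_nonincreasing[OF assms(1)])
    fix y :: real assume y: "0 \<le> y" "y \<le> x"
    with assms have y1: "1 - y/2 > 0" by simp
    have *: "(1 - y/2) powr (4/5) = (1 - y/2) * (1 - y/2) powr (-1/5)"
      using powr_add[of "1 - y/2" 1 "-1/5"] y1 by simp
    have "(g has_real_derivative (- (399/2500) * y^3) * (1 - y/2) powr (-1/5)) (at y)"
      unfolding g_def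
      apply (rule derivative_eq_intros refl | use y1 in simp; fail)+
      unfolding * by (simp add: field_simps power2_eq_square power3_eq_cube)
    moreover have "(- (399/2500) * y^3) * (1 - y/2) powr (-1/5) \<le> 0"
      using y by (simp add: mult_nonpos_nonneg)
    ultimately show "\<exists>d. (g has_real_derivative d) (at y) \<and> d \<le> 0" by blast
  qed
  then have "(1 + 2/5 * x + 9/50 * x^2 + 21/250 * x^3) * (1 - x/2) powr (4/5) \<le> 1"
    by (simp add: g_def)
  moreover have "(1 - x/2) powr (-4/5) = 1 / (1 - x/2) powr (4/5)"
    using powr_minus_divide[of "1 - x/2" "4/5"] by simp
  moreover have "(1 - x/2) powr (4/5) > 0" using assms by simp
  ultimately show ?thesis by (simp only: pos_le_divide_eq)
qed

text \<open>On the removed piece near 0 the factor \<open>(1 - v) powr (- a)\<close> is at most its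
  value at \<open>d\<close>, and \<open>v powr (a - 1)\<close> integrates to
  \<open>d powr a / a\<close>.\<close>

lemma Beta_truncated_ge:
  fixes a d :: real
  assumes a: "0 < a" "a < 1" and d: "0 < d" "d < 1"
  defines "f \<equiv> \<lambda>v::real. v powr (a - 1) * (1 - v) powr (- a)"
  shows "f absolutely_integrable_on {d..1}"
    and "integral {d..1} f \<ge> Beta a (1 - a) - (d / (1 - d)) powr a / a"
proof -
  have B: "(f has_integral Beta a (1 - a)) {0..1}"
    using has_integral_Beta_real[of a "1 - a"] a by (simp add: f_def)
  have f0: "f v \<ge> 0" for v by (simp add: f_def)
  have i1: "f integrable_on {0..d}" "f integrable_on {d..1}"
    using B d by (auto intro: integrable_on_subinterval[of f "{0..1}"])
  show "f absolutely_integrable_on {d..1}"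
    using i1 f0 by (intro nonnegative_absolutely_integrable_1) auto
  have "((\<lambda>v. v powr (a - 1) * (1 - d) powr (- a)) has_integral
          d powr (a - 1 + 1) / (a - 1 + 1) * (1 - d) powr (- a)) {0..d}"
    using a d by (intro has_integral_mult_left has_integral_powr_from_0) auto
  then have P: "((\<lambda>v. v powr (a - 1) * (1 - d) powr (- a)) has_integral (d / (1 - d)) powr a / a) {0..d}"
    using d by (simp add: powr_minus_divide powr_divide mult.commute)
  have "integral {0..d} f \<le> (d / (1 - d)) powr a / a"
    using integrable_integral[OF i1(1)] P
  proof (rule has_integral_le)
    fix v assume "v \<in> {0..d}"
    then show "f v \<le> v powr (a - 1) * (1 - d) powr (- a)"
      unfolding f_def using a d by (intro mult_left_mono powr_mono2') auto
  qed
  moreover have "integral {0..d} f + integral {d..1} f = Beta a (1 - a)"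
    using d B by (subst Henstock_Kurzweil_Integration.integral_combine) (auto simp: has_integral_iff)
  ultimately show "integral {d..1} f \<ge> Beta a (1 - a) - (d / (1 - d)) powr a / a" by simp
qed

text \<open>Over the half-line the integral would equal
  \<open>c powr (- a) * Beta a (1 - a)\<close>. Beyond 1 the integrand is at most
  \<open>x powr (- a - 1)\<close>, which explains the loss \<open>1 / a\<close>.\<close>

lemma powr_kernel_integral_ge:
  fixes a c :: real
  assumes a: "0 < a" "a < 1" and c: "0 < c"
  shows "(\<lambda>x. x powr (- a) / (c + x)) integrable_on {0..1}"
    and "integral {0..1} (\<lambda>x. x powr (- a) / (c + x)) \<ge> c powr (- a) * Beta a (1 - a) - 1 / a"
proof -
  define f where "f = (\<lambda>v::real. v powr (a - 1) * (1 - v) powr (- a))"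
  \<comment> \<open>the substitution \<open>v = c / (c + x)\<close> turns the kernel into the truncated beta integrand\<close>
  define g where "g = (\<lambda>x. c / (c + x))"
  \<comment> \<open>\<open>d\<close> is the image of \<open>x = 1\<close>; since
    \<open>d / (1 - d) = c\<close>, the truncation error of the beta integral becomes
    \<open>c powr a / a\<close>.\<close>
  define d where "d = c / (1 + c)"
  have d: "0 < d" "d < 1" "d / (1 - d) = c" using c by (auto simp: d_def field_simps)
  note T = Beta_truncated_ge[OF a d(1,2), folded f_def, unfolded d(3)]
  have der: "(g has_field_derivative (- c / (c + x)^2)) (at x within {0..1})" if "x \<in> {0..1}" for x
    unfolding g_def using that c
    by (auto intro!: derivative_eq_intros simp: power2_eq_square)
  have inj: "inj_on g {0..1}"
    using c by (auto simp: inj_on_def g_def field_simps)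
  have img: "g ` {0..1} = {d..1}"
  proof (intro equalityI subsetI)
    fix v assume "v \<in> {d..1}"
    then have v: "0 < v" "d \<le> v" "v \<le> 1" using d by auto
    then have "c / v - c \<in> {0..1}" "v = g (c / v - c)"
      using c by (auto simp: g_def d_def field_simps)
    then show "v \<in> g ` {0..1}" by blast
  qed (use c in \<open>auto simp: g_def d_def intro!: divide_left_mono\<close>)
  have eq: "\<bar>- c / (c + x)^2\<bar> * f (g x) = c powr a * (x powr (- a) / (c + x))" if "x \<in> {0..1}" for x
  proof (cases "x = 0")
    \<comment> \<open>Both sides vanish here, because \<open>0 powr b = 0\<close> by
      convention.\<close>
    case True then show ?thesis using c by (simp add: f_def g_def)
  next
    case False
    with that have x: "x > 0" by simp
    have 1: "1 - g x = x / (c + x)" using x c by (simp add: g_def field_simps)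
    have 2: "(x / (c + x)) powr (- a) = (c + x) powr a / x powr a"
      using x c by (simp add: powr_divide powr_minus_divide)
    have 3: "(c / (c + x)) powr (a - 1) = c powr a * (c + x) / (c * (c + x) powr a)"
      using x c by (simp add: powr_divide powr_diff)
    have 4: "(c + x) powr a \<noteq> 0" "x powr a \<noteq> 0" "\<bar>- c / (c + x)^2\<bar> = c / ((c + x) * (c + x))"
      using x c by (auto simp: power2_eq_square)
    show ?thesis unfolding f_def 1 2 4(3) unfolding g_def 3 using x c 4(1,2)
      by (simp add: powr_minus_divide)
  qed
  have "(\<lambda>x. \<bar>- c / (c + x)^2\<bar> * f (g x)) absolutely_integrable_on {0..1} \<and>
           integral {0..1} (\<lambda>x. \<bar>- c / (c + x)^2\<bar> * f (g x)) = integral {d..1} f"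
    using has_absolute_integral_change_of_variables_1'[of "{0..1}" g "\<lambda>x. - c / (c + x)^2" f "integral {d..1} f"]
      der inj T(1) by (simp add: img)
  then have "((\<lambda>x. \<bar>- c / (c + x)^2\<bar> * f (g x)) has_integral integral {d..1} f) {0..1}"
    by (auto simp: has_integral_iff dest: set_lebesgue_integral_eq_integral(1))
  then have "((\<lambda>x. c powr a * (x powr (- a) / (c + x))) has_integral integral {d..1} f) {0..1}"
    by (rule has_integral_eq[OF eq, rotated])
  from has_integral_mult_right[OF this, of "c powr (-a)"]
  have I: "((\<lambda>x. x powr (- a) / (c + x)) has_integral c powr (- a) * integral {d..1} f) {0..1}"
    using c by (simp add: mult.assoc[symmetric] powr_add[symmetric])
  then show "(\<lambda>x. x powr (- a) / (c + x)) integrable_on {0..1}" by blast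
  have "c powr (- a) * (Beta a (1 - a) - c powr a / a) \<le> c powr (- a) * integral {d..1} f"
    using T(2) by (intro mult_left_mono) auto
  moreover have "c powr (- a) * (Beta a (1 - a) - c powr a / a) = c powr (- a) * Beta a (1 - a) - 1 / a"
    using c by (simp add: right_diff_distrib powr_add[symmetric])
  ultimately show "integral {0..1} (\<lambda>x. x powr (- a) / (c + x)) \<ge> c powr (- a) * Beta a (1 - a) - 1 / a"
    using I by (simp add: has_integral_iff)
qed

text \<open>Euler's reflection formula, transferred from the complex Gamma function. It covers
  integers too: there both sides are 0, as Gamma is 0 at its poles and
  \<open>pi / 0 = 0\<close>.\<close>

lemma Beta_reflection_real:
  fixes a :: real
  shows "Beta a (1 - a) = pi / sin (pi * a)"
proof -
  have "complex_of_real (Beta a (1 - a)) = complex_of_real (pi / sin (pi * a))"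
    using Gamma_reflection_complex[of "complex_of_real a"]
    by (simp add: Beta_def Gamma_complex_of_real[symmetric] sin_of_real[symmetric])
  then show ?thesis by (simp only: of_real_eq_iff)
qed

lemma power_powr_eq: "(x ^ n) powr b = x powr (real n * b)" if "x > 0" for x b :: real
  using that by (simp add: powr_powr flip: powr_realpow)

lemma set_integrable_one_minus_square_powr:
  fixes a :: real
  assumes "0 \<le> a" "a < 1"
  shows "set_integrable lborel {0<..<1} (\<lambda>t. (1 - t\<^sup>2) powr (- a))"
proof (rule set_integrable_bound)
  \<comment> \<open>The majorant is \<open>(1 - t) powr (- a)\<close>, written as the beta integrand
    with parameters 1 and \<open>1 - a\<close>.\<close>
  show "set_integrable lborel {0<..<1} (\<lambda>t. t powr (1 - 1) * (1 - t) powr ((1 - a) - 1))"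
    by (rule set_integrable_subset[OF integrable_Beta]) (use assms in auto)
  show "set_borel_measurable lborel {0<..<1} (\<lambda>t. (1 - t\<^sup>2) powr (- a))"
    by (simp add: set_borel_measurable_def)
  show "AE t in lborel. t \<in> {0<..<1} \<longrightarrow>
      norm ((1 - t\<^sup>2) powr (- a)) \<le> norm (t powr (1 - 1) * (1 - t) powr ((1 - a) - 1))"
  proof (intro AE_I2 impI)
    fix t :: real assume t: "t \<in> {0<..<1}"
    then have "1 - t \<le> 1 - t\<^sup>2" by (simp add: power2_eq_square mult_left_le)
    then have "(1 - t\<^sup>2) powr (- a) \<le> (1 - t) powr (- a)"
      using t assms by (intro powr_mono2') auto
    with t show "norm ((1 - t\<^sup>2) powr (- a)) \<le> norm (t powr (1 - 1) * (1 - t) powr ((1 - a) - 1))"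
      by simp
  qed
qed

lemma set_integrable_extremal_kernel:
  fixes a r :: real
  assumes "0 \<le> a" "a < 1" "0 \<le> r" "r < 1"
  shows "set_integrable lborel {0<..<1} (\<lambda>t. (1 - t\<^sup>2) powr (- a) / (1 - r * t))"
proof (rule set_integrable_bound)
  show "set_integrable lborel {0<..<1} (\<lambda>t. (1 - t\<^sup>2) powr (- a) / (1 - r))"
    using set_integrable_one_minus_square_powr[OF assms(1,2)] by simp
  show "set_borel_measurable lborel {0<..<1} (\<lambda>t. (1 - t\<^sup>2) powr (- a) / (1 - r * t))"
    by (simp add: set_borel_measurable_def)
  show "AE t in lborel. t \<in> {0<..<1} \<longrightarrow>
      norm ((1 - t\<^sup>2) powr (- a) / (1 - r * t)) \<le> norm ((1 - t\<^sup>2) powr (- a) / (1 - r))"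
  proof (intro AE_I2 impI)
    fix t :: real assume t: "t \<in> {0<..<1}"
    then have "r * t \<le> r" using assms by (simp add: mult_left_le)
    then show "norm ((1 - t\<^sup>2) powr (- a) / (1 - r * t)) \<le> norm ((1 - t\<^sup>2) powr (- a) / (1 - r))"
      using assms by (auto intro!: divide_left_mono)
  qed
qed

text \<open>Division with remainder: \<open>P x = P (- c) + (c + x) * Q x\<close> with
  \<open>Q\<close> quadratic. Only the constant \<open>P (- c)\<close> meets the singular kernel;
  \<open>S\<close> is the exact integral of \<open>x powr (-4/5) * Q x\<close>. The sign of
  \<open>P (- c)\<close> lets the lower bound for the kernel integral be multiplied by it.\<close>

lemma cubic_kernel_has_integral:
  fixes c :: real
  assumes c: "0 < c"
  defines "P \<equiv> \<lambda>x::real. 1 + 2/5 * x + 9/50 * x^2 + 21/250 * x^3"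
  defines "S \<equiv> 2 + 9/50 * (5/6 - 5 * c) + 21/250 * (5/11 - 5/6 * c + 5 * c^2)"
  assumes Pc: "P (- c) \<ge> 0"
  obtains J where "((\<lambda>x. x powr (-4/5) * P x / (c + x)) has_integral J) {0..1}"
    "J \<ge> P (- c) * (c powr (-4/5) * Beta (4/5) (1/5) - 5/4) + S"
proof -
  define K where "K = integral {0..1} (\<lambda>x. x powr (- (4/5)) / (c + x))"
  have 0: "((\<lambda>x. x powr (-4/5) / (c + x)) has_integral K) {0..1}"
    and K: "K \<ge> c powr (-4/5) * Beta (4/5) (1/5) - 5/4"
    using powr_kernel_integral_ge[of "4/5" c] c unfolding K_def
    by (auto simp: has_integral_iff)
  have 1: "((\<lambda>x::real. x powr (-4/5)) has_integral 5) {0..1}"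
    and 2: "((\<lambda>x::real. x powr (1/5)) has_integral 5/6) {0..1}"
    and 3: "((\<lambda>x::real. x powr (6/5)) has_integral 5/11) {0..1}"
    using has_integral_powr_from_0[of "-4/5" 1] has_integral_powr_from_0[of "1/5" 1]
      has_integral_powr_from_0[of "6/5" 1] by simp_all
  have sum: "((\<lambda>x. P (- c) * (x powr (-4/5) / (c + x)) + (2/5 * x powr (-4/5)
        + 9/50 * (x powr (1/5) - c * x powr (-4/5))
        + 21/250 * ((x powr (6/5) - c * x powr (1/5)) + c^2 * x powr (-4/5)))) has_integral
      P (- c) * K + (2/5 * 5 + 9/50 * (5/6 - c * 5) + 21/250 * ((5/11 - c * (5/6)) + c^2 * 5))) {0..1}"
    by (intro has_integral_add has_integral_diff has_integral_mult_right 0 1 2 3)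
  have eq: "P (- c) * (x powr (-4/5) / (c + x)) + (2/5 * x powr (-4/5)
        + 9/50 * (x powr (1/5) - c * x powr (-4/5))
        + 21/250 * ((x powr (6/5) - c * x powr (1/5)) + c^2 * x powr (-4/5))) =
      x powr (-4/5) * P x / (c + x)" if x: "x \<in> {0..1}" for x
  proof (cases "x = 0")
    case False
    have 1: "x powr (1/5) = x * x powr (-4/5)" "x powr (6/5) = x^2 * x powr (-4/5)"
      using powr_add[of x 1 "-4/5"] powr_add[of x 2 "-4/5"] x False by simp_all
    show ?thesis unfolding 1 P_def using x c
      by (simp add: divide_simps) algebra
  qed simp
  from has_integral_eq[OF eq sum] have J: "((\<lambda>x. x powr (-4/5) * P x / (c + x)) has_integral
      P (- c) * K + S) {0..1}" by (simp add: S_def algebra_simps)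
  show thesis
    using that[OF J] mult_left_mono[OF K Pc] by simp
qed

text \<open>With \<open>x = 1 - t\<close> one has \<open>1 - t^2 = 2 * x * (1 - x/2)\<close> and
  \<open>1 - r * t = r * (c + x)\<close>. Bounding the smooth factor
  \<open>(1 - x/2) powr (-4/5)\<close> below by its Taylor cubic leaves the integral just
  computed.\<close>

lemma extremal_integral_ge:
  fixes r :: real
  assumes r: "0 < r" "r < 1"
  defines "P \<equiv> \<lambda>x::real. 1 + 2/5 * x + 9/50 * x^2 + 21/250 * x^3"
  defines "c \<equiv> (1 - r) / r"
  defines "S \<equiv> 2 + 9/50 * (5/6 - 5 * c) + 21/250 * (5/11 - 5/6 * c + 5 * c^2)"
  assumes Pc: "P (- c) \<ge> 0"
  shows "(LINT t:{0<..<1}|lborel. (1 - t\<^sup>2) powr (-4/5) / (1 - r * t)) \<ge>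
     2 powr (-4/5) / r * (P (- c) * (c powr (-4/5) * Beta (4/5) (1/5) - 5/4) + S)"
proof -
  have c: "c > 0" using r by (simp add: c_def)
  obtain J where J: "((\<lambda>x. x powr (-4/5) * P x / (c + x)) has_integral J) {0..1}"
    "J \<ge> P (- c) * (c powr (-4/5) * Beta (4/5) (1/5) - 5/4) + S"
    using cubic_kernel_has_integral[OF c] Pc unfolding P_def S_def by blast
  have "((\<lambda>t. (1 - t) powr (-4/5) * P (1 - t) / (c + (1 - t))) has_integral J) {0..1}"
    using has_integral_affinity[of "\<lambda>x. x powr (-4/5) * P x / (c + x)" J 0 1 "-1" 1] J(1) by simp
  from has_integral_mult_right[OF this, of "2 powr (-4/5) / r"]
  have lower: "((\<lambda>t. 2 powr (-4/5) / r * ((1 - t) powr (-4/5) * P (1 - t) / (c + (1 - t)))) has_integral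
     2 powr (-4/5) / r * J) {0<..<1}" by (simp add: has_integral_Icc_iff_Ioo)
  define h where "h = (\<lambda>t::real. (1 - t\<^sup>2) powr (-4/5) / (1 - r * t))"
  have si: "set_integrable lborel {0<..<1} h"
    using set_integrable_extremal_kernel[of "4/5" r] r by (simp add: h_def)
  have "2 powr (-4/5) / r * J \<le> integral {0<..<1} h"
    using lower integrable_integral[OF set_borel_integral_eq_integral(1)[OF si]]
  proof (rule has_integral_le)
    fix t :: real assume t: "t \<in> {0<..<1}"
    have *: "1 - t\<^sup>2 = (1 - t) * (2 * (1 - (1 - t) / 2))" by (simp add: power2_eq_square field_simps)
    have pos: "0 < 1 - t" "0 < 1 - (1 - t) / 2" using t by auto
    have 1: "(1 - t\<^sup>2) powr (-4/5) = (1 - t) powr (-4/5) * (2 powr (-4/5) * (1 - (1 - t)/2) powr (-4/5))"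
      unfolding * using pos by (simp only: powr_mult mult_pos_pos less_imp_le zero_less_numeral)
    have 2: "1 - r * t = r * (c + (1 - t))" using r by (simp add: c_def field_simps)
    have 3: "2 powr (-4/5) / r * ((1 - t) powr (-4/5) * P (1 - t) / (c + (1 - t))) =
      (1 - t) powr (-4/5) * (2 powr (-4/5) * P (1 - t)) / (r * (c + (1 - t)))" by simp
    show "2 powr (-4/5) / r * ((1 - t) powr (-4/5) * P (1 - t) / (c + (1 - t))) \<le> h t"
      unfolding h_def 1 2 3
    proof (intro divide_right_mono mult_left_mono)
      show "P (1 - t) \<le> (1 - (1 - t) / 2) powr (-4/5)"
        unfolding P_def by (rule cubic_le_powr_four_fifths) (use t in auto)
    qed (use r c t in auto)
  qed
  moreover have "(LINT t:{0<..<1}|lborel. h t) = integral {0<..<1} h"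
    by (rule set_borel_integral_eq_integral(2)[OF si])
  moreover have "2 powr (-4/5) / r * (P (- c) * (c powr (-4/5) * Beta (4/5) (1/5) - 5/4) + S)
    \<le> 2 powr (-4/5) / r * J" using J(2) r by (intro mult_left_mono) auto
  ultimately show ?thesis unfolding h_def by linarith
qed

section \<open>Numerical bounds for the beta values and the gain factor\<close>

lemma abs_sin_diff_le: "\<bar>sin x - sin y\<bar> \<le> \<bar>x - y\<bar>" for x y :: real
proof -
  have "\<bar>sin x - sin y\<bar> = 2 * (\<bar>sin ((x - y) / 2)\<bar> * \<bar>cos ((x + y) / 2)\<bar>)"
    by (simp add: sin_diff_sin abs_mult)
  also have "\<dots> \<le> 2 * (\<bar>(x - y) / 2\<bar> * 1)"
    by (intro mult_left_mono mult_mono abs_sin_x_le_abs_x) auto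
  finally show ?thesis by simp
qed

text \<open>By symmetry the sine is taken at \<open>x = pi / 5\<close>, where
  \<open>sin x \<ge> x - x^3 / 6\<close> and \<open>x^2 \<le> 0.395\<close>. In the second bound
  \<open>pi\<close> cancels and leaves \<open>5 / (1 - 395/6000)\<close>.\<close>

lemma sin_four_fifths_pi_bounds:
  shows "sin (pi * (4/5)) \<ge> 4/7" and "pi / sin (pi * (4/5)) \<le> 536/100"
proof -
  define x where "x = pi / 5"
  have pi: "3.14 < pi" "pi < 3.1416" using pi_approx by auto
  have x: "0 < x" "x^2 \<le> 395/1000"
    using power_mono[of pi "3.1416" 2] pi by (auto simp: x_def power_divide)
  have "\<bar>sin x - x\<bar> \<le> inverse (fact 3) * \<bar>x\<bar> ^ 3"
    using Maclaurin_sin_bound[of x 3] by (simp add: sin_coeff_def numeral_eq_Suc)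
  also have "\<dots> = x^3 / 6"
    using x by (simp add: fact_numeral)
  finally have "sin x \<ge> x - x^3 / 6" by linarith
  moreover have "x^3 \<le> 395/1000 * x"
    using mult_right_mono[OF x(2), of x] x(1) by (simp add: power2_eq_square power3_eq_cube)
  ultimately have s: "sin x \<ge> (1 - 395/6000) * x" by (simp add: algebra_simps)
  have eq: "sin (pi * (4/5)) = sin x"
    using sin_pi_minus[of x] by (simp add: x_def field_simps)
  show "sin (pi * (4/5)) \<ge> 4/7" unfolding eq using s pi by (simp add: x_def)
  have "0 < (1 - 395/6000) * x" using x by simp
  then have "pi / sin x \<le> pi / ((1 - 395/6000) * x)"
    using s by (intro divide_left_mono) auto
  also have "\<dots> \<le> 536/100" using pi by (simp add: x_def)
  finally show "pi / sin (pi * (4/5)) \<le> 536/100" unfolding eq .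
qed

text \<open>By reflection this compares two sines. They differ by at most \<open>pi / 10^6\<close>,
  and \<open>sin (pi * (4/5)) \<ge> 4/7\<close>, so the relative change is about 5.5 millionths at
  most.\<close>

lemma Beta_near_four_fifths_le:
  "Beta (800001/1000000) (1 - 800001/1000000) \<le> (1 + 6/1000000) * Beta (4/5) (1/5 :: real)"
proof -
  define s t where "s = sin (pi * (4/5))" and "t = sin (pi * (800001/1000000))"
  have s: "s \<ge> 4/7" using sin_four_fifths_pi_bounds by (simp add: s_def)
  have "\<bar>s - t\<bar> \<le> \<bar>pi * (4/5) - pi * (800001/1000000)\<bar>"
    unfolding s_def t_def by (rule abs_sin_diff_le)
  also have "\<dots> = pi / 1000000" by (simp add: abs_if field_simps)
  also have "\<dots> \<le> 3.1416 / 1000000" using pi_approx by simp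
  finally have "t \<ge> s - 3.1416 / 1000000" by linarith
  then have t: "(1 + 6/1000000) * t \<ge> s" "t > 0" using s by auto
  have "pi / t \<le> (1 + 6/1000000) * (pi / s)"
    using t s by (simp add: field_simps)
  then show ?thesis
    using Beta_reflection_real[of "4/5"] Beta_reflection_real[of "800001/1000000"]
    by (simp add: s_def t_def)
qed

lemma Beta_four_fifths_ge_one: "1 \<le> Beta (4/5) (1/5 :: real)"
proof -
  define s where "s = sin (pi * (4/5))"
  have "0 < s" "s \<le> pi"
    using sin_four_fifths_pi_bounds(1) sin_le_one[of "pi * (4/5)"] pi_ge_two
    unfolding s_def by linarith+
  then show ?thesis using Beta_reflection_real[of "4/5"] unfolding s_def[symmetric] by simp
qed

text \<open>The radius is chosen so that \<open>(1 - r) / r = 4\<^sup>-\<^sup>5\<close> has a rational fifth root. \<open>M\<close> is a lower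
  bound of \<open>1 - \<bar>z\<bar>\<^sup>2\<close> on the disc with diameter \<open>[r, r + 2 \<rho>]\<close>, where \<open>\<rho> = 2\<^sup>-\<^sup>1\<^sup>8 (1 - r)\<close>.\<close>

lemma weighted_extremal_integral_ge:
  fixes r M :: real
  assumes r: "r = 1024 / 1025"
  assumes M: "M = (1 - r) * (1 + r) * (1 - 1 / 2^17)"
  shows "(1 + 9/100000) * Beta (4/5) (1/5) \<le>
    M powr (4/5) * (LINT t:{0<..<1}|lborel. (1 - t\<^sup>2) powr (-4/5) / (1 - r * t))"
proof -
  define B where "B = Beta (4/5) (1/5 :: real)"
  define L where "L = (LINT t:{0<..<1}|lborel. (1 - t\<^sup>2) powr (-4/5) / (1 - r * t))"
  define P where "P = (\<lambda>x::real. 1 + 2/5 * x + 9/50 * x^2 + 21/250 * x^3)"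
  define c where "c = (1/1024 :: real)"
  define S where "S = 2 + 9/50 * (5/6 - 5 * c) + 21/250 * (5/11 - 5/6 * c + 5 * c^2)"
  have B: "B \<le> 536/100"
    using Beta_reflection_real[of "4/5"] sin_four_fifths_pi_bounds(2) by (simp add: B_def)
  have c: "(1 - r) / r = c" "c powr (-4/5) = 256"
  proof -
    show "(1 - r) / r = c" by (simp add: r c_def)
    have "c = 2 powr (-10)" by (simp add: c_def powr_minus powr_numeral)
    then show "c powr (-4/5) = 256" by (simp add: powr_powr powr_numeral)
  qed
  have "2 powr (-4/5) / r * (P (- c) * (256 * B - 5/4) + S) \<le> L"
    unfolding B_def L_def S_def P_def c(1)[symmetric] c(2)[symmetric]
    by (rule extremal_integral_ge) (simp_all add: r power2_eq_square power3_eq_cube)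
  then have h1: "M powr (4/5) * (2 powr (-4/5) / r * (P (- c) * (256 * B - 5/4) + S)) \<le> M powr (4/5) * L"
    by (intro mult_left_mono) auto
  have h2: "M powr (4/5) * 2 powr (-4/5) = (M / 2) powr (4/5)"
    using powr_divide[of M 2 "4/5"] powr_minus_divide[of "2::real" "4/5"] by simp
  \<comment> \<open>The ratio of the left side to \<open>r / 256\<close> is about 0.9997988, here
    rounded down. Comparing \<open>y ^ 5\<close> with \<open>(M / 2) ^ 4\<close> turns the claim
    into rational arithmetic.\<close>
  have h3: "(M / 2) powr (4/5) \<ge> r * (999798/1000000) / 256"
  proof -
    define y where "y = r * (999798/1000000) / 256"
    have y: "y > 0" "y ^ 5 \<le> (M / 2) ^ 4" by (simp_all add: y_def M r power_divide)
    have "y = (y ^ 5) powr (1/5)" using y(1) by (simp only: power_powr_eq) simp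
    also have "\<dots> \<le> ((M / 2) ^ 4) powr (1/5)" using y by (intro powr_mono2) auto
    also have "\<dots> = (M / 2) powr (4/5)"
      using power_powr_eq[of "M / 2" 4 "1/5"] by (simp add: M r)
    finally show ?thesis by (simp add: y_def)
  qed
  have 1: "(M / 2) powr (4/5) / r * (P (- c) * (256 * B - 5/4) + S) \<le> M powr (4/5) * L"
    using h1 unfolding h2[symmetric] by simp
  have 2: "(M / 2) powr (4/5) / r \<ge> 999798/1000000 / 256"
    using h3 by (simp add: r)
  have B0: "B \<ge> 1"
    unfolding B_def by (rule Beta_four_fifths_ge_one)
  \<comment> \<open>Both sides are affine in \<open>B\<close>. The slope on the right is slightly
    below 1 (about 0.99941), so the surplus comes from the constant term
    \<open>(S - 5/4 * P (- c)) / 256\<close>, about 0.00366. This is why a sharp upper bound on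
    \<open>B\<close> is required; the margin at 5.36 is narrow.\<close>
  have "(1 + 9/100000) * B \<le> 999798/1000000 / 256 * (P (- c) * (256 * B - 5/4) + S)"
    using B by (simp add: P_def S_def c_def field_simps)
  also have "\<dots> \<le> (M / 2) powr (4/5) / r * (P (- c) * (256 * B - 5/4) + S)"
    using 2 B0 by (intro mult_right_mono) (auto simp: P_def S_def c_def field_simps)
  also note 1
  finally show ?thesis by (simp add: B_def L_def)
qed

text \<open>Spends the surplus \<open>9/100000\<close>: 6 millionths go to replacing
  \<open>Beta (4/5) (1/5)\<close> by \<open>Beta a (1 - a)\<close>, 10 millionths to raising the
  exponent of \<open>M\<close> to \<open>a\<close>, and the factor \<open>1 + 1 / 2^34\<close> pays
  for points off the real axis. At least \<open>1/20000\<close> remains.\<close>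

lemma weighted_extremal_integral_ge_Beta:
  fixes r M a :: real
  assumes r: "r = 1024 / 1025"
  assumes M: "M = (1 - r) * (1 + r) * (1 - 1 / 2^17)"
  assumes a: "a = 800001 / 1000000"
  shows "(1 + 1/20000) * Beta a (1 - a) \<le> M powr a *
    (LINT t:{0<..<1}|lborel. (1 - t\<^sup>2) powr (-4/5) / (1 - r * t)) / (1 + 1 / 2^34)"
proof -
  define L where "L = (LINT t:{0<..<1}|lborel. (1 - t\<^sup>2) powr (-4/5) / (1 - r * t))"
  define B where "B = Beta (4/5) (1/5 :: real)"
  have 1: "(1 + 9/100000) * B \<le> M powr (4/5) * L"
    using weighted_extremal_integral_ge[OF r M] by (simp add: B_def L_def)
  have B0: "B \<ge> 1"
    unfolding B_def by (rule Beta_four_fifths_ge_one)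
  have M0: "2 powr (-10) \<le> M" by (simp add: M r powr_minus powr_numeral)
  \<comment> \<open>From \<open>M \<ge> 2 powr (-10)\<close> and \<open>ln 2 < 1\<close>, the extra
    factor \<open>M powr (a - 4/5)\<close> costs at most \<open>1/100000\<close>.\<close>
  have "1 - 1/100000 \<le> 1 + (- 10 * (1/1000000)) * ln (2::real)"
    using ln_2_less_1 by simp
  also have "\<dots> \<le> exp ((- 10 * (1/1000000)) * ln (2::real))" by (rule exp_ge_add_one_self)
  also have "\<dots> = (2 powr (-10)) powr (1/1000000)" by (simp add: powr_powr) (simp add: powr_def)
  also have "\<dots> \<le> M powr (1/1000000)" using M0 by (intro powr_mono2) auto
  finally have 2: "1 - 1/100000 \<le> M powr (1/1000000)" .
  have "(1 + 1/20000) * Beta a (1 - a) \<le> (1 + 1/20000) * ((1 + 6/1000000) * B)"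
    using Beta_near_four_fifths_le unfolding a B_def by (intro mult_left_mono) auto
  also have "\<dots> \<le> (1 - 1/100000) * ((1 + 9/100000) * B) / (1 + 1 / 2^34)"
    using B0 by (simp add: field_simps)
  also have "\<dots> \<le> M powr (1/1000000) * (M powr (4/5) * L) / (1 + 1 / 2^34)"
    using B0 by (intro divide_right_mono mult_mono[OF 2 1]) auto
  also have "M powr (1/1000000) * (M powr (4/5) * L) = M powr a * L"
    by (simp add: a mult.assoc[symmetric] powr_add[symmetric])
  finally show ?thesis by (simp add: L_def)
qed

text \<open>Bernoulli's inequality gives a doubling for every 20000 factors, and
  \<open>1100000 = 55 * 20000\<close>; this fixes the threshold for \<open>p\<close>.\<close>

lemma two_power_55_le_powr:
  fixes p :: real
  assumes "p \<ge> 1100000"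
  shows "(1 + 1/20000) powr p \<ge> 2 ^ 55"
proof -
  have "(2::real) \<le> (1 + 1/20000) ^ 20000"
    using Bernoulli_inequality[of "1/20000 :: real" 20000] by simp
  then have "(2::real) ^ 55 \<le> ((1 + 1/20000) ^ 20000) ^ 55"
    by (rule power_mono) simp
  also have "\<dots> = (1 + 1/20000) powr 1100000"
    by (subst power_mult[symmetric], subst powr_numeral) simp_all
  also have "\<dots> \<le> (1 + 1/20000) powr p" using assms by (intro powr_mono) auto
  finally show ?thesis .
qed

section \<open>Weighted norms on the disc\<close>

text \<open>The disc is cut into annuli where \<open>1 - |z|^2\<close> lies between
  \<open>q ^ Suc n\<close> and \<open>q ^ n\<close>. The area is at most \<open>pi * q ^ n\<close>
  and the integrand at most \<open>512 ^ Suc n\<close>, so with \<open>q = 1/1024\<close> a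
  geometric series of ratio 1/2 results. The value of \<open>q\<close> makes
  \<open>q powr (-9/10)\<close> an integer.\<close>

lemma nn_integral_disc_powr_le:
  fixes s :: real
  assumes s: "s \<ge> -9/10"
  shows "(\<integral>\<^sup>+ z\<in>ball 0 1. ennreal ((1 - (norm z)\<^sup>2) powr s) \<partial>(lborel :: complex measure))
    \<le> ennreal (1024 * pi)"
proof -
  define q where "q = (1/1024 :: real)"
  have q: "q powr (-9/10) = 512"
  proof -
    have "q = 2 powr (-10)" by (simp add: q_def powr_minus powr_numeral)
    then show ?thesis by (simp add: powr_powr powr_numeral)
  qed
  define A where "A = (\<lambda>n. {z::complex. q ^ Suc n < 1 - (norm z)\<^sup>2 \<and> 1 - (norm z)\<^sup>2 \<le> q ^ n})"
  have A: "A n \<in> sets borel" for n unfolding A_def by simp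
  have lim: "(\<lambda>n. q ^ n) \<longlonglongrightarrow> 0" by (rule LIMSEQ_power_zero) (simp add: q_def)
  have cover: "\<exists>n. z \<in> A n" if "z \<in> ball 0 1" for z
  proof -
    have z: "0 < 1 - (norm z)\<^sup>2" using that by (simp add: abs_square_less_1)
    \<comment> \<open>The annulus of \<open>z\<close> is found from the least such \<open>n\<close>.
      It is not 0, because \<open>q ^ 0 = 1\<close>, and its predecessor indexes the
      annulus.\<close>
    then have "\<exists>n. q ^ n < 1 - (norm z)\<^sup>2"
      using order_tendstoD(2)[OF lim z] by (auto simp: eventually_sequentially)
    then obtain n where n: "q ^ n < 1 - (norm z)\<^sup>2" "\<And>m. m < n \<Longrightarrow> \<not> q ^ m < 1 - (norm z)\<^sup>2"
      using exists_least_iff[of "\<lambda>n. q ^ n < 1 - (norm z)\<^sup>2"] by blast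
    from n(1) have "n \<noteq> 0" by (cases n) auto
    then obtain m where "n = Suc m" by (cases n) auto
    with n show ?thesis unfolding A_def by (metis (mono_tags, lifting) lessI linorder_not_less mem_Collect_eq)
  qed
  have bound: "(1 - (norm z)\<^sup>2) powr s \<le> 512 * 512 ^ n" if "z \<in> A n" for n z
  proof -
    have z: "q ^ Suc n < 1 - (norm z)\<^sup>2" "1 - (norm z)\<^sup>2 \<le> 1" using that by (auto simp: A_def)
    have qn: "0 < q ^ Suc n" by (simp add: q_def)
    have "(1 - (norm z)\<^sup>2) powr s \<le> (1 - (norm z)\<^sup>2) powr (-9/10)"
      using z qn s by (intro powr_mono') auto
    also have "\<dots> \<le> (q ^ Suc n) powr (-9/10)"
      using z qn by (intro powr_mono2') auto
    also have "\<dots> = (q powr (-9/10)) ^ Suc n"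
      by (simp add: q_def power_powr_eq powr_power mult.commute del: power_Suc)
    finally show ?thesis unfolding q by simp
  qed
  have meas: "emeasure lborel (A n) \<le> ennreal (pi * q ^ n)" for n
  proof -
    define R S where "R = sqrt (1 - q ^ Suc n)" and "S = sqrt (1 - q ^ n)"
    have qn: "0 < q ^ n" "q ^ n \<le> 1" "q ^ Suc n < q ^ n" by (auto simp: q_def power_le_one)
    have RS: "R\<^sup>2 = 1 - q ^ Suc n" "S\<^sup>2 = 1 - q ^ n" "0 \<le> S" "S < R"
      using qn power_le_one[of q "Suc n"] by (auto simp: R_def S_def q_def simp del: power_Suc)
    have "A n \<subseteq> ball 0 R - ball 0 S"
    proof
      fix z assume "z \<in> A n"
      then have "(norm z)\<^sup>2 < R\<^sup>2" "S\<^sup>2 \<le> (norm z)\<^sup>2" unfolding RS A_def by auto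
      then have "norm z < R" "S \<le> norm z"
        using RS by (auto intro: power2_less_imp_less power2_le_imp_le)
      then show "z \<in> ball 0 R - ball 0 S" by simp
    qed
    then have "emeasure lborel (A n) \<le> emeasure lborel (ball (0::complex) R - ball 0 S)"
      by (intro emeasure_mono) auto
    also have "\<dots> = emeasure lborel (ball (0::complex) R) - emeasure lborel (ball (0::complex) S)"
      using RS by (intro emeasure_Diff) (auto simp: emeasure_ball)
    also have "\<dots> = ennreal (pi * R\<^sup>2) - ennreal (pi * S\<^sup>2)"
      using RS by (simp add: emeasure_ball eval_unit_ball_vol DIM_complex)
    also have "\<dots> = ennreal (pi * R\<^sup>2 - pi * S\<^sup>2)" by (rule ennreal_minus) simp
    also have "\<dots> \<le> ennreal (pi * q ^ n)"
    proof (rule ennreal_leI)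
      have "pi * R\<^sup>2 - pi * S\<^sup>2 = pi * (q ^ n - q ^ Suc n)" unfolding RS by (simp add: algebra_simps)
      also have "\<dots> \<le> pi * q ^ n" using qn by (intro mult_left_mono) (auto simp: q_def)
      finally show "pi * R\<^sup>2 - pi * S\<^sup>2 \<le> pi * q ^ n" .
    qed
    finally show ?thesis .
  qed
  have "(\<integral>\<^sup>+ z\<in>ball 0 1. ennreal ((1 - (norm z)\<^sup>2) powr s) \<partial>(lborel :: complex measure))
      \<le> (\<integral>\<^sup>+ z. (\<Sum>n. ennreal (512 * 512 ^ n) * indicator (A n) z) \<partial>lborel)"
  proof (rule nn_integral_mono)
    fix z :: complex
    show "ennreal ((1 - (norm z)\<^sup>2) powr s) * indicator (ball 0 1) z
        \<le> (\<Sum>n. ennreal (512 * 512 ^ n) * indicator (A n) z)"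
    proof (cases "z \<in> ball 0 1")
      case True
      then obtain n where n: "z \<in> A n" using cover by blast
      have "ennreal ((1 - (norm z)\<^sup>2) powr s) * indicator (ball 0 1) z
          \<le> ennreal (512 * 512 ^ n) * indicator (A n) z"
        using bound[OF n] True n by (simp add: ennreal_leI)
      also have "\<dots> = (\<Sum>k\<in>{n}. ennreal (512 * 512 ^ k) * indicator (A k) z)"
        by (simp only: sum.insert sum.empty finite.emptyI empty_iff not_False_eq_True add_0_right)
      also have "\<dots> \<le> (\<Sum>n. ennreal (512 * 512 ^ n) * indicator (A n) z)"
        by (rule sum_le_suminf[OF summableI]) auto
      finally show ?thesis .
    qed simp
  qed
  also have "\<dots> = (\<Sum>n. \<integral>\<^sup>+ z. ennreal (512 * 512 ^ n) * indicator (A n) z \<partial>lborel)"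
    using A by (intro nn_integral_suminf) simp
  also have "\<dots> = (\<Sum>n. ennreal (512 * 512 ^ n) * emeasure lborel (A n))"
    using A by (simp add: nn_integral_cmult_indicator)
  also have "\<dots> \<le> (\<Sum>n. ennreal (512 * pi * (1/2) ^ n))"
  proof (rule suminf_le)
    fix n
    have "ennreal (512 * 512 ^ n) * emeasure lborel (A n) \<le> ennreal (512 * 512 ^ n) * ennreal (pi * q ^ n)"
      by (intro mult_left_mono meas) simp
    also have "\<dots> = ennreal (512 * pi * (1/2) ^ n)"
    proof -
      have "512 ^ n * q ^ n = (1/2) ^ n" by (simp add: power_mult_distrib[symmetric] q_def)
      then show ?thesis
        by (subst ennreal_mult[symmetric]) (auto simp: q_def mult_ac)
    qed
    finally show "ennreal (512 * 512 ^ n) * emeasure lborel (A n) \<le> ennreal (512 * pi * (1/2) ^ n)" .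
  qed auto
  also have "\<dots> = ennreal (1024 * pi)"
  proof -
    have "(\<lambda>n. 512 * pi * (1/2) ^ n) sums (512 * pi * (1 / (1 - 1/2)))"
      by (intro sums_mult geometric_sums) simp
    then show ?thesis by (intro suminf_ennreal_eq) auto
  qed
  finally show ?thesis .
qed

section \<open>The test function on the disc\<close>

text \<open>Keeps \<open>1 - z^2\<close> away from the branch cut of the principal power.\<close>

lemma Re_one_minus_square_pos:
  fixes z :: complex
  assumes "norm z < 1"
  shows "0 < Re (1 - z\<^sup>2)"
proof -
  have "Re (z\<^sup>2) \<le> norm (z\<^sup>2)" by (rule complex_Re_le_cmod)
  also have "\<dots> < 1" using assms by (simp add: norm_power abs_square_less_1)
  finally show ?thesis by simp
qed

lemma holomorphic_one_minus_square_powr: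
  "(\<lambda>z. (1 - z\<^sup>2) powr b) holomorphic_on ball 0 1" for b :: complex
proof -
  have "1 - z\<^sup>2 \<notin> \<real>\<^sub>\<le>\<^sub>0" if "z \<in> ball 0 1" for z :: complex
    using Re_one_minus_square_pos[of z] that by (auto simp: complex_nonpos_Reals_iff)
  then show ?thesis by (intro holomorphic_intros) auto
qed

lemma norm_one_minus_square_powr_le:
  fixes z :: complex and b :: real
  assumes "norm z < 1" "0 \<le> b"
  shows "norm ((1 - z\<^sup>2) powr complex_of_real (- b)) \<le> (1 - (norm z)\<^sup>2) powr (- b)"
proof -
  have "0 < 1 - (norm z)\<^sup>2" using assms by (simp add: abs_square_less_1)
  moreover have "1 - (norm z)\<^sup>2 \<le> norm (1 - z\<^sup>2)"
    using norm_triangle_ineq2[of 1 "z\<^sup>2"] by (simp add: norm_power)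
  moreover have "norm ((1 - z\<^sup>2) powr complex_of_real (- b)) = norm (1 - z\<^sup>2) powr (- b)"
    by (subst norm_powr_real_powr') auto
  ultimately show ?thesis using assms by (auto intro: powr_mono2')
qed

section \<open>From integrals to Bergman norms\<close>

lemma nn_integral_disk_measure:
  assumes "f \<in> borel_measurable borel"
  shows "(\<integral>\<^sup>+ z. f z \<partial>disk_measure \<alpha>) =
    (\<integral>\<^sup>+ z\<in>ball 0 1. ennreal ((\<alpha> + 1) * (1 - (norm z)\<^sup>2) powr \<alpha> / pi) * f z \<partial>lborel)"
proof -
  have [measurable]: "f \<in> borel_measurable (restrict_space lborel (ball 0 1))"
    using assms by (intro measurable_restrict_space1) simp
  have [measurable]: "(\<lambda>z::complex. ennreal ((\<alpha> + 1) * (1 - (norm z)\<^sup>2) powr \<alpha> / pi))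
      \<in> borel_measurable (restrict_space lborel (ball 0 1))"
    by (intro measurable_restrict_space1) simp
  show ?thesis unfolding disk_measure_def
    by (subst nn_integral_density) (auto simp: nn_integral_restrict_space)
qed

lemma bergman_norm_le_one:
  assumes "(\<integral>\<^sup>+ z. ennreal (norm (f z) powr p) \<partial>disk_measure \<alpha>) \<le> 1" "p > 0"
  shows "bergman_norm p \<alpha> f \<le> 1"
proof -
  define I where "I = (\<integral>\<^sup>+ z. ennreal (norm (f z) powr p) \<partial>disk_measure \<alpha>)"
  have I: "I \<le> 1" "I \<noteq> top" using assms(1) by (auto simp: I_def top_unique)
  then have "enn2real I \<le> 1" by (simp add: enn2real_leI)
  then have "enn2real I powr (1 / p) \<le> 1" using assms(2) by (intro powr_le1) auto
  then show ?thesis using I unfolding bergman_norm_def I_def[symmetric] Let_def by simp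
qed

text \<open>The p-th root is strictly increasing on finite integrals, and an infinite integral has
  norm \<open>top\<close>, which exceeds every real number.\<close>

lemma less_bergman_norm:
  assumes "ennreal (b powr p) < (\<integral>\<^sup>+ z. ennreal (norm (f z) powr p) \<partial>disk_measure \<alpha>)"
    and "p > 0" "b \<ge> 0"
  shows "ennreal b < bergman_norm p \<alpha> f"
proof -
  define I where "I = (\<integral>\<^sup>+ z. ennreal (norm (f z) powr p) \<partial>disk_measure \<alpha>)"
  show ?thesis
  proof (cases "I = top")
    case False
    then have "b powr p < enn2real I"
      using assms(1) unfolding I_def[symmetric]
      by (cases I) (auto simp: ennreal_less_iff)
    then have "(b powr p) powr (1 / p) < enn2real I powr (1 / p)"
      using assms(2) by (intro powr_less_mono2) auto
    then have "b < enn2real I powr (1 / p)" using assms by (simp add: powr_powr)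
    then show ?thesis using False assms(3) unfolding bergman_norm_def I_def[symmetric] Let_def
      by (simp add: ennreal_less_iff)
  qed (simp add: bergman_norm_def I_def Let_def)
qed

section \<open>Lower bounds for the image off the real axis\<close>

text \<open>With \<open>X = 1 - t * Re z\<close> and \<open>Y = t * Im z\<close> the real part is
  \<open>X / (X^2 + Y^2)\<close>. The aperture condition gives \<open>|Y| \<le> d * X\<close>, which
  costs the factor \<open>1 + d^2\<close>, and \<open>r \<le> Re z\<close> gives
  \<open>X \<le> 1 - r * t\<close>.\<close>

lemma Re_kernel_ge:
  fixes z :: complex and r t d :: real
  assumes t: "0 < t" "t < 1" and r: "0 \<le> r" "r \<le> Re z" and z: "Re z < 1" "\<bar>Im z\<bar> \<le> d * (1 - Re z)"
  shows "1 / ((1 - r * t) * (1 + d\<^sup>2)) \<le> Re (1 / (1 - complex_of_real t * z))"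
proof -
  define X Y where "X = 1 - t * Re z" and "Y = t * Im z"
  have "t * Re z \<le> Re z" using t r by (simp add: mult_left_le_one_le)
  then have X: "1 - Re z \<le> X" "0 < X" using z by (auto simp: X_def)
  have Xr: "X \<le> 1 - r * t" using r t by (simp add: X_def mult.commute mult_left_mono)
  have d: "0 \<le> d" using z by (metis abs_ge_zero diff_gt_0_iff_gt order_trans mult_le_cancel_right_pos mult_zero_left)
  have "\<bar>Y\<bar> \<le> \<bar>Im z\<bar>" using t by (simp add: Y_def abs_mult mult_left_le_one_le)
  also have "\<dots> \<le> d * X" using z X d by (meson mult_left_mono order_trans)
  finally have "Y\<^sup>2 \<le> (d * X)\<^sup>2" using X d by (simp add: abs_le_square_iff[symmetric] abs_mult)
  then have Q: "X\<^sup>2 + Y\<^sup>2 \<le> X * (X * (1 + d\<^sup>2))" by (simp add: power2_eq_square algebra_simps)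
  have Re: "Re (1 / (1 - complex_of_real t * z)) = X / (X\<^sup>2 + Y\<^sup>2)"
    by (simp add: Re_divide X_def Y_def)
  have "1 / ((1 - r * t) * (1 + d\<^sup>2)) \<le> 1 / (X * (1 + d\<^sup>2))"
    using X Xr by (intro divide_left_mono mult_right_mono mult_pos_pos) (auto intro: add_pos_nonneg)
  also have "\<dots> = X / (X * (X * (1 + d\<^sup>2)))" using X by simp
  also have "\<dots> \<le> X / (X\<^sup>2 + Y\<^sup>2)"
    using X Q by (intro divide_left_mono mult_pos_pos) (auto intro: add_pos_nonneg)
  finally show ?thesis unfolding Re .
qed

text \<open>On \<open>(0, 1)\<close> the test function is real and nonnegative, so the kernel bound
  integrates to a bound for the real part of the image, hence for its modulus.\<close>

lemma norm_hilbert_op_ge: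
  fixes z :: complex and a r d K :: real
  assumes a: "0 \<le> a" "a < 1" and K: "0 \<le> K"
    and r: "0 \<le> r" "r \<le> Re z" and z: "norm z < 1" "\<bar>Im z\<bar> \<le> d * (1 - Re z)"
  shows "K * (LINT t:{0<..<1}|lborel. (1 - t\<^sup>2) powr (- a) / (1 - r * t)) / (1 + d\<^sup>2) \<le>
    norm (hilbert_op (\<lambda>z. of_real K * (1 - z\<^sup>2) powr complex_of_real (- a)) z)"
proof -
  define F where "F = (\<lambda>t::real. of_real K * (1 - (complex_of_real t)\<^sup>2) powr complex_of_real (- a)
    / (1 - complex_of_real t * z))"
  \<comment> \<open>\<open>G\<close> has the real power in place of the complex one; the two
    integrands agree on \<open>(0, 1)\<close>.\<close>
  define G where "G = (\<lambda>t::real. complex_of_real (K * (1 - t\<^sup>2) powr (- a)) / (1 - complex_of_real t * z))"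
  have Rez: "Re z < 1" using complex_Re_le_cmod[of z] z by simp
  have FG: "F t = G t" if "t \<in> {0<..<1}" for t
  proof -
    have "0 < 1 - t\<^sup>2" using that by (simp add: abs_square_less_1)
    then have "(1 - (complex_of_real t)\<^sup>2) powr complex_of_real (- a) = complex_of_real ((1 - t\<^sup>2) powr (- a))"
      using powr_of_real[of "1 - t\<^sup>2" "- a"] by simp
    then show ?thesis by (simp add: F_def G_def)
  qed
  have intG: "set_integrable lborel {0<..<1} G"
  proof (rule set_integrable_bound)
    show "set_integrable lborel {0<..<1} (\<lambda>t. K * (1 - t\<^sup>2) powr (- a) / (1 - norm z))"
      using set_integrable_one_minus_square_powr[OF a] by simp
    show "set_borel_measurable lborel {0<..<1} G"
      unfolding G_def set_borel_measurable_def by simp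
    show "AE t in lborel. t \<in> {0<..<1} \<longrightarrow> norm (G t) \<le> norm (K * (1 - t\<^sup>2) powr (- a) / (1 - norm z))"
    proof (intro AE_I2 impI)
      fix t :: real assume t: "t \<in> {0<..<1}"
      have "norm (complex_of_real t * z) \<le> norm z"
        using t by (simp add: norm_mult mult_left_le_one_le)
      then have "1 - norm z \<le> norm (1 - complex_of_real t * z)"
        using norm_triangle_ineq2[of 1 "complex_of_real t * z"] by simp
      then show "norm (G t) \<le> norm (K * (1 - t\<^sup>2) powr (- a) / (1 - norm z))"
        using z K by (auto simp: G_def norm_divide norm_mult intro!: divide_left_mono mult_pos_pos)
    qed
  qed
  have ReI: "set_integrable lborel {0<..<1} (\<lambda>t. Re (G t))"
    using intG unfolding set_integrable_def by (auto dest: integrable_Re)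
  have "hilbert_op (\<lambda>z. of_real K * (1 - z\<^sup>2) powr complex_of_real (- a)) z = (LINT t:{0<..<1}|lborel. F t)"
    by (simp add: hilbert_op_def F_def)
  also have "\<dots> = (LINT t:{0<..<1}|lborel. G t)"
    by (intro set_lebesgue_integral_cong) (auto simp: FG)
  finally have H: "Re (hilbert_op (\<lambda>z. of_real K * (1 - z\<^sup>2) powr complex_of_real (- a)) z)
      = (LINT t:{0<..<1}|lborel. Re (G t))"
    using intG by (simp add: set_lebesgue_integral_def set_integrable_def flip: integral_Re)
  have "K * (LINT t:{0<..<1}|lborel. (1 - t\<^sup>2) powr (- a) / (1 - r * t)) / (1 + d\<^sup>2) =
      (LINT t:{0<..<1}|lborel. K * ((1 - t\<^sup>2) powr (- a) / (1 - r * t)) / (1 + d\<^sup>2))"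
    by (simp only: set_integral_mult_right set_integral_divide_zero)
  also have "\<dots> \<le> (LINT t:{0<..<1}|lborel. Re (G t))"
  proof (rule set_integral_mono[OF _ ReI])
    show "set_integrable lborel {0<..<1} (\<lambda>t. K * ((1 - t\<^sup>2) powr (- a) / (1 - r * t)) / (1 + d\<^sup>2))"
      using set_integrable_extremal_kernel[OF a r(1)] r Rez
      by (intro set_integrable_divide set_integrable_mult_right) auto
    fix t :: real assume t: "t \<in> {0<..<1}"
    have "K * (1 - t\<^sup>2) powr (- a) * (1 / ((1 - r * t) * (1 + d\<^sup>2))) \<le>
        K * (1 - t\<^sup>2) powr (- a) * Re (1 / (1 - complex_of_real t * z))"
      using t r z Rez K by (intro mult_left_mono Re_kernel_ge) auto
    also have "\<dots> = Re (G t)"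
      by (simp add: G_def Re_divide)
    finally show "K * ((1 - t\<^sup>2) powr (- a) / (1 - r * t)) / (1 + d\<^sup>2) \<le> Re (G t)" by simp
  qed
  also have "\<dots> \<le> norm (hilbert_op (\<lambda>z. of_real K * (1 - z\<^sup>2) powr complex_of_real (- a)) z)"
    unfolding H[symmetric] by (rule complex_Re_le_cmod)
  finally show ?thesis .
qed

section \<open>The lower bound for the operator norm\<close>

lemma hilbert_norm_gt_Beta:
  fixes a p :: real
  assumes a: "a = 800001 / 1000000" and p: "p \<ge> 1100000"
  shows "ennreal (Beta a (1 - a)) < hilbert_norm p (a * p - 2)"
proof -
  define \<alpha> where "\<alpha> = a * p - 2"
  \<comment> \<open>Normalizes \<open>f\<close>: the annulus estimate bounds its p-th power integral
    by \<open>(\<alpha> + 1) * K powr p / pi * (1024 * pi)\<close>, which this \<open>K\<close>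
    makes equal to 1.\<close>
  define K where "K = (1024 * (\<alpha> + 1)) powr (- (1 / p))"
  define f where "f = (\<lambda>z. complex_of_real K * (1 - z\<^sup>2) powr complex_of_real (- (4/5)))"
  have \<alpha>: "\<alpha> + 1 > 0" using p by (simp add: \<alpha>_def a)
  have K: "K > 0" "K powr p = 1 / (1024 * (\<alpha> + 1))"
  proof -
    show "K > 0" using \<alpha> by (simp add: K_def)
    have "K powr p = (1024 * (\<alpha> + 1)) powr (- 1)"
      using p unfolding K_def powr_powr by simp
    then show "K powr p = 1 / (1024 * (\<alpha> + 1))"
      using \<alpha> by (simp add: powr_minus_divide)
  qed
  have hol: "f holomorphic_on ball 0 1"
    unfolding f_def by (intro holomorphic_intros holomorphic_one_minus_square_powr)
  have "(\<integral>\<^sup>+ z. ennreal (norm (f z) powr p) \<partial>disk_measure \<alpha>) \<le>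
      (\<integral>\<^sup>+ z. ennreal (K powr p * (1 - (norm z)\<^sup>2) powr (- (4/5) * p)) \<partial>disk_measure \<alpha>)"
  proof (intro nn_integral_mono ennreal_leI)
    fix z assume "z \<in> space (disk_measure \<alpha>)"
    then have z: "norm z < 1" by (simp add: disk_measure_def space_restrict_space)
    then have "norm (f z) \<le> K * (1 - (norm z)\<^sup>2) powr (- (4/5))"
      using norm_one_minus_square_powr_le[OF z, of "4/5"] K(1)
      by (simp add: f_def norm_mult)
    then have "norm (f z) powr p \<le> (K * (1 - (norm z)\<^sup>2) powr (- (4/5))) powr p"
      using p by (intro powr_mono2) auto
    also have "\<dots> = K powr p * (1 - (norm z)\<^sup>2) powr (- (4/5) * p)"
      using K(1) by (simp add: powr_mult powr_powr)
    finally show "norm (f z) powr p \<le> K powr p * (1 - (norm z)\<^sup>2) powr (- (4/5) * p)" .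
  qed
  also have "\<dots> = (\<integral>\<^sup>+ z\<in>ball (0::complex) 1. ennreal ((\<alpha> + 1) * (1 - (norm z)\<^sup>2) powr \<alpha> / pi) *
      ennreal (K powr p * (1 - (norm z)\<^sup>2) powr (- (4/5) * p)) \<partial>lborel)"
    by (intro nn_integral_disk_measure) simp
  also have "\<dots> = (\<integral>\<^sup>+ z. ennreal ((\<alpha> + 1) * K powr p / pi) *
      (ennreal ((1 - (norm z)\<^sup>2) powr (\<alpha> - 4/5 * p)) * indicator (ball (0::complex) 1) z) \<partial>lborel)"
  proof (rule nn_integral_cong)
    fix z :: complex
    have "(1 - (norm z)\<^sup>2) powr \<alpha> * (1 - (norm z)\<^sup>2) powr (- (4/5) * p) = (1 - (norm z)\<^sup>2) powr (\<alpha> - 4/5 * p)"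
      by (simp flip: powr_add)
    then have eq: "(\<alpha> + 1) * (1 - (norm z)\<^sup>2) powr \<alpha> / pi * (K powr p * (1 - (norm z)\<^sup>2) powr (- (4/5) * p))
        = (\<alpha> + 1) * K powr p / pi * (1 - (norm z)\<^sup>2) powr (\<alpha> - 4/5 * p)"
      by (simp add: field_simps)
    have nn: "0 \<le> (\<alpha> + 1) * (1 - (norm z)\<^sup>2) powr \<alpha> / pi" "0 \<le> (\<alpha> + 1) * K powr p / pi"
      using \<alpha> by simp_all
    show "ennreal ((\<alpha> + 1) * (1 - (norm z)\<^sup>2) powr \<alpha> / pi) *
      ennreal (K powr p * (1 - (norm z)\<^sup>2) powr (- (4/5) * p)) * indicator (ball 0 1) z
      = ennreal ((\<alpha> + 1) * K powr p / pi) *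
      (ennreal ((1 - (norm z)\<^sup>2) powr (\<alpha> - 4/5 * p)) * indicator (ball 0 1) z)"
      by (simp only: mult.assoc[where 'a=ennreal, symmetric] ennreal_mult'[OF nn(1), symmetric]
        ennreal_mult'[OF nn(2), symmetric] eq)
  qed
  also have "\<dots> = ennreal ((\<alpha> + 1) * K powr p / pi) *
      (\<integral>\<^sup>+ z\<in>ball (0::complex) 1. ennreal ((1 - (norm z)\<^sup>2) powr (\<alpha> - 4/5 * p)) \<partial>lborel)"
    by (intro nn_integral_cmult borel_measurable_times_ennreal borel_measurable_indicator) simp_all
  \<comment> \<open>The exponent is \<open>\<alpha> - 4/5 * p = p / 10^6 - 2\<close>, which is at
    least \<open>-9/10\<close> exactly when \<open>p \<ge> 1100000\<close>.\<close>
  also have "\<dots> \<le> ennreal ((\<alpha> + 1) * K powr p / pi) * ennreal (1024 * pi)"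
    using p by (intro mult_left_mono nn_integral_disc_powr_le) (auto simp: \<alpha>_def a)
  also have "\<dots> = 1"
    using \<alpha> by (simp add: K(2) flip: ennreal_mult)
  finally have bn: "bergman_norm p \<alpha> f \<le> 1"
    using p by (intro bergman_norm_le_one) auto
  then have "bergman_norm p \<alpha> f < top" by (rule le_less_trans) simp
  with hol bn have mem: "f \<in> {f \<in> bergman_space p \<alpha>. bergman_norm p \<alpha> f \<le> 1}"
    by (simp add: bergman_space_def)

  define r where "r = (1024 / 1025 :: real)"
  define \<rho> where "\<rho> = (1 / (1025 * 2^18) :: real)"
  define M where "M = (1 - r) * (1 + r) * (1 - 1 / 2^17)"
  define L where "L = (LINT t:{0<..<1}|lborel. (1 - t\<^sup>2) powr (-4/5) / (1 - r * t)) / (1 + 1 / 2^34)"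
  define B where "B = Beta a (1 - a)"
  define D where "D = ball (complex_of_real (r + \<rho>)) \<rho>"
  have BL: "(1 + 1/20000) * B \<le> M powr a * L"
    using weighted_extremal_integral_ge_Beta[OF r_def M_def a] by (simp add: L_def B_def)
  have B: "B > 0"
    unfolding B_def Beta_reflection_real a by (intro divide_pos_pos sin_gt_zero) auto
  have M: "M > 0" by (simp add: M_def r_def)
  have L: "L \<ge> 0"
  proof (rule ccontr)
    assume "\<not> L \<ge> 0"
    then have "M powr a * L \<le> 0" by (intro mult_nonneg_nonpos) auto
    moreover have "0 < (1 + 1/20000) * B" using B by simp
    ultimately show False using BL by linarith
  qed
  have D: "norm z < 1" "M \<le> 1 - (norm z)\<^sup>2" "1 - (norm z)\<^sup>2 \<le> 1 / 2^9"
    and HD: "K * L \<le> norm (hilbert_op f z)" if "z \<in> D" for z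
  proof -
    have "norm (z - complex_of_real (r + \<rho>)) < \<rho>" using that by (simp add: D_def dist_norm norm_minus_commute)
    then have *: "\<bar>Re z - (r + \<rho>)\<bar> < \<rho>" "\<bar>Im z\<bar> < \<rho>"
      using abs_Re_le_cmod[of "z - complex_of_real (r + \<rho>)"] abs_Im_le_cmod[of "z - complex_of_real (r + \<rho>)"]
      by auto
    then have Re: "r \<le> Re z" "Re z \<le> r + 2 * \<rho>" by auto
    have "norm z \<le> norm (complex_of_real (r + \<rho>)) + norm (z - complex_of_real (r + \<rho>))"
      using norm_triangle_sub[of z "complex_of_real (r + \<rho>)"] .
    then have nz: "norm z \<le> r + 2 * \<rho>"
      using \<open>norm (z - complex_of_real (r + \<rho>)) < \<rho>\<close> by (simp add: r_def \<rho>_def del: of_real_add)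
    then show n1: "norm z < 1" by (simp add: r_def \<rho>_def)
    have "(norm z)\<^sup>2 \<le> (r + 2 * \<rho>)\<^sup>2" using nz by (intro power_mono) auto
    then show "M \<le> 1 - (norm z)\<^sup>2"
      by (simp add: M_def r_def \<rho>_def power2_eq_square)
    have "r\<^sup>2 \<le> (norm z)\<^sup>2"
      using Re complex_Re_le_cmod[of z] by (intro power_mono) (auto simp: r_def)
    then show "1 - (norm z)\<^sup>2 \<le> 1 / 2^9" by (simp add: r_def power2_eq_square)
    \<comment> \<open>On \<open>D\<close>, \<open>|Im z| < \<rho> = (1 - r) / 2^18\<close> while
      \<open>1 - Re z \<ge> (1 - r) / 2\<close>. The square of the aperture \<open>1 / 2^17\<close>
      is the \<open>1 / 2^34\<close> in \<open>L\<close>.\<close>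
    have "\<bar>Im z\<bar> \<le> 1 / 2^17 * (1 - Re z)"
      using * Re by (simp add: r_def \<rho>_def)
    from norm_hilbert_op_ge[OF _ _ _ _ Re(1) n1 this, of "4/5" K] K(1)
    show "K * L \<le> norm (hilbert_op f z)"
      by (simp add: L_def f_def r_def power_divide)
  qed
  \<comment> \<open>A constant lower bound for the weighted integrand on \<open>D\<close>. With
    \<open>u = 1 - |z|^2\<close>, the weight splits as
    \<open>u powr \<alpha> = u powr (-2) * (u powr a) powr p\<close>; the first factor is at least
    \<open>2^18\<close> since \<open>u \<le> 1 / 2^9\<close>, the second at least
    \<open>(M powr a) powr p\<close>.\<close>
  define c where "c = (\<alpha> + 1) / pi * (K powr p * (2^18 * (M powr a * L) powr p))"
  have "ennreal (B powr p) < ennreal (c * (pi * \<rho>\<^sup>2))"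
  proof -
    \<comment> \<open>The gain \<open>2^55\<close> outweighs the normalization and the area of
      \<open>D\<close>: the bracket equals \<open>2^27 / 1025^2\<close>, about 128.\<close>
    have "B powr p * 1 < B powr p * (1 / 1024 * 2^18 * \<rho>\<^sup>2 * 2^55)"
      using B by (intro mult_strict_left_mono) (auto simp: \<rho>_def power2_eq_square)
    also have "\<dots> \<le> B powr p * (1 / 1024 * 2^18 * \<rho>\<^sup>2 * (1 + 1/20000) powr p)"
      using two_power_55_le_powr[OF p] by (intro mult_left_mono) auto
    also have "\<dots> = 1 / 1024 * 2^18 * \<rho>\<^sup>2 * ((1 + 1/20000) * B) powr p"
      using B by (subst powr_mult) auto
    also have "\<dots> \<le> 1 / 1024 * 2^18 * \<rho>\<^sup>2 * (M powr a * L) powr p"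
      using BL B p by (intro mult_left_mono powr_mono2) auto
    also have "1 / 1024 = (\<alpha> + 1) * K powr p" using \<alpha> unfolding K(2) by (simp add: divide_simps)
    also have "(\<alpha> + 1) * K powr p * 2^18 * \<rho>\<^sup>2 * (M powr a * L) powr p = c * (pi * \<rho>\<^sup>2)"
      by (simp add: c_def)
    finally show ?thesis by (simp add: ennreal_less_iff)
  qed
  also have "ennreal (c * (pi * \<rho>\<^sup>2)) = ennreal c * emeasure lborel D"
  proof -
    have "emeasure lborel D = ennreal (pi * \<rho>\<^sup>2)"
      by (simp add: D_def emeasure_ball eval_unit_ball_vol DIM_complex \<rho>_def)
    moreover have "0 \<le> c" using \<alpha> by (simp add: c_def)
    ultimately show ?thesis by (simp add: ennreal_mult')
  qed
  also have "\<dots> = (\<integral>\<^sup>+ z. ennreal c * indicator D z \<partial>lborel)"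
    by (simp add: D_def nn_integral_cmult_indicator)
  also have "\<dots> \<le> (\<integral>\<^sup>+ z\<in>ball (0::complex) 1. ennreal ((\<alpha> + 1) * (1 - (norm z)\<^sup>2) powr \<alpha> / pi) *
      (ennreal ((K * L) powr p) * indicator D z) \<partial>lborel)"
  proof (rule nn_integral_mono)
    fix z :: complex
    show "ennreal c * indicator D z \<le> ennreal ((\<alpha> + 1) * (1 - (norm z)\<^sup>2) powr \<alpha> / pi) *
      (ennreal ((K * L) powr p) * indicator D z) * indicator (ball 0 1) z"
    proof (cases "z \<in> D")
      case True
      define u where "u = 1 - (norm z)\<^sup>2"
      have u: "0 < u" "M \<le> u" "u \<le> 1 / 2^9" using D[OF True] M by (auto simp: u_def)
      have "2^18 * (M powr a) powr p \<le> u powr (-2) * (u powr a) powr p"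
      proof (intro mult_mono powr_mono2)
        have "(1 / 2^9) powr (-2) \<le> u powr (-2)" using u by (intro powr_mono2') auto
        then show "2^18 \<le> u powr (-2)" by (simp add: powr_minus_divide powr_numeral power_divide)
      qed (use M u p a in auto)
      also have "\<dots> = u powr \<alpha>" using u by (simp add: \<alpha>_def powr_powr flip: powr_add)
      finally have "2^18 * (M powr a) powr p * ((\<alpha> + 1) / pi * (K * L) powr p)
          \<le> u powr \<alpha> * ((\<alpha> + 1) / pi * (K * L) powr p)"
        using \<alpha> by (intro mult_right_mono) auto
      moreover have "c = 2^18 * (M powr a) powr p * ((\<alpha> + 1) / pi * (K * L) powr p)"
        using K L M by (simp add: c_def powr_mult)
      ultimately have "c \<le> (\<alpha> + 1) * u powr \<alpha> / pi * (K * L) powr p" by (simp add: mult_ac)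
      then show ?thesis using True D(1)[OF True] \<alpha>
        unfolding u_def by (simp add: ennreal_leI flip: ennreal_mult)
    qed simp
  qed
  \<comment> \<open>The density formula is applied to a multiple of the indicator of
    \<open>D\<close>, whose measurability is immediate; the image of \<open>f\<close> enters only by
    pointwise comparison.\<close>
  also have "\<dots> = (\<integral>\<^sup>+ z. ennreal ((K * L) powr p) * indicator D z \<partial>disk_measure \<alpha>)"
  proof (rule nn_integral_disk_measure[symmetric])
    have "D \<in> sets borel" by (simp add: D_def)
    then show "(\<lambda>z. ennreal ((K * L) powr p) * indicator D z) \<in> borel_measurable borel"
      by (intro borel_measurable_times_ennreal borel_measurable_indicator borel_measurable_const)
  qed
  also have "\<dots> \<le> (\<integral>\<^sup>+ z. ennreal (norm (hilbert_op f z) powr p) \<partial>disk_measure \<alpha>)"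
  proof (rule nn_integral_mono)
    fix z :: complex
    show "ennreal ((K * L) powr p) * indicator D z \<le> ennreal (norm (hilbert_op f z) powr p)"
      using HD[of z] K L p by (cases "z \<in> D") (auto intro!: ennreal_leI powr_mono2)
  qed
  finally have "ennreal B < bergman_norm p \<alpha> (hilbert_op f)"
    using p B by (intro less_bergman_norm) auto
  also have "\<dots> \<le> hilbert_norm p \<alpha>"
    unfolding hilbert_norm_def by (rule SUP_upper[OF mem])
  finally show ?thesis by (simp add: B_def \<alpha>_def)
qed

theorem theorem1p1:
  fixes a\<^sub>0 p\<^sub>0 :: real and \<alpha> :: "real \<Rightarrow> real"
  assumes "a\<^sub>0 = 800001 / 1000000"
    and "p\<^sub>0 = 1100000"
    and "\<And>p. \<alpha> p = a\<^sub>0 * p - 2"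
  shows "(\<forall>p \<ge> p\<^sub>0. -1 < \<alpha> p \<and> \<alpha> p < p - 2
            \<and> hilbert_norm p (\<alpha> p) > ennreal (Beta a\<^sub>0 (1 - a\<^sub>0)))
       \<and> (\<forall>(m::int) \<ge> 550000. \<forall>p \<beta> a. p = 2 * real_of_int m \<longrightarrow> \<beta> = 2 * a\<^sub>0 * real_of_int m - 2
            \<longrightarrow> a = (\<beta> + 2) / p
            \<longrightarrow> \<beta> = \<alpha> p \<and> Beta a (1 - a) = pi / sin (pi * a)
                \<and> hilbert_norm p \<beta> \<noteq> ennreal (Beta a (1 - a)))"
proof -
  have gt: "hilbert_norm p (\<alpha> p) > ennreal (Beta a\<^sub>0 (1 - a\<^sub>0))" if "p \<ge> p\<^sub>0" for p
    using hilbert_norm_gt_Beta[OF assms(1), of p] that assms(2,3) by simp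
  show ?thesis
  proof (intro conjI allI impI)
    fix p assume "p \<ge> p\<^sub>0"
    then show "-1 < \<alpha> p" "\<alpha> p < p - 2" "hilbert_norm p (\<alpha> p) > ennreal (Beta a\<^sub>0 (1 - a\<^sub>0))"
      using gt[of p] by (simp_all add: assms)
  next
    fix m :: int and p \<beta> a :: real
    assume m: "550000 \<le> m" and p: "p = 2 * real_of_int m" and \<beta>: "\<beta> = 2 * a\<^sub>0 * real_of_int m - 2"
      and a: "a = (\<beta> + 2) / p"
    have "550000 \<le> real_of_int m" using m by linarith
    then have p0: "p \<ge> p\<^sub>0" "p > 0" using p assms(2) by auto
    show "\<beta> = \<alpha> p" using assms(3) \<beta> p by simp
    have "a = a\<^sub>0" using a \<beta> p p0 by simp
    show "Beta a (1 - a) = pi / sin (pi * a)" by (rule Beta_reflection_real)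
    show "hilbert_norm p \<beta> \<noteq> ennreal (Beta a (1 - a))"
      using gt[OF p0(1)] \<open>a = a\<^sub>0\<close> \<open>\<beta> = \<alpha> p\<close> by auto
  qed
qed

end
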